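(* Let $A=A_{1}\times A_{2}$, where $A_1,A_2$ are commutative rings with nonzero identity, and let $M=M_{1}\times M_{2}$ be the $A$-module where $M_{1}$ is an $A_{1}$-module and $M_{2}$ is an $A_{2}$-module. Suppose that $P=P_{1}\times P_{2}$ is a proper submodule of $M$, where $P_i$ is a submodule of $M_i$ for $i=1,2$. The following statements are equivalent. (i) $P$ is a classical 1-absorbing prime submodule of $M$. (ii) $P_{1}=M_{1}$ and $P_{2}$ is a classical prime submodule of $M_{2}$, or $P_{2}=M_{2}$ and $P_{1}$ is a classical prime submodule of $M_{1}$. (iii) $P$ is a classical prime submodule of $M$.
   Context: All rings are commutative with nonzero identity; the given modules are nonzero and unital; $A_1\times A_2$ acts on $M_1\times M_2$ componentwise. For a ring $A$ and an $A$-module $M$: a proper submodule $P$ of $M$ is a classical prime submodule if whenever $abm\in P$ for $a,b\in A$ and $m\in M$, then $am\in P$ or $bm\in P$; it is a classical 1-absorbing prime submodule if whenever $abcm\in P$ for nonunits $a,b,c\in A$ and $m\in M$, then $abm\in P$ or $cm\in P$. *)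

theory Defs
  imports "HOL-Algebra.Algebra"
begin

text \<open>
  The record type of modules extends that of rings, so the additive part of the product module is
  taken from the product of the underlying ring records; the multiplicative fields of a module
  record are irrelevant.
\<close>

definition MDirProd ::
    "('a, 'm, 'k) module_scheme \<Rightarrow> ('b, 'n, 'l) module_scheme \<Rightarrow> ('a \<times> 'b, 'm \<times> 'n) module"
  where "MDirProd M N = ring.extend (RDirProd M N)
    (module.fields (\<lambda>(a, b) (x, y). (a \<odot>\<^bsub>M\<^esub> x, b \<odot>\<^bsub>N\<^esub> y)))"

definition classical_prime_submodule ::
    "'m set \<Rightarrow> ('a, 'r) ring_scheme \<Rightarrow> ('a, 'm, 'k) module_scheme \<Rightarrow> bool"
  where "classical_prime_submodule P A M \<longleftrightarrow>
    submodule P A M \<and> P \<noteq> carrier M \<and>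
    (\<forall>a \<in> carrier A. \<forall>b \<in> carrier A. \<forall>m \<in> carrier M.
      (a \<otimes>\<^bsub>A\<^esub> b) \<odot>\<^bsub>M\<^esub> m \<in> P \<longrightarrow> a \<odot>\<^bsub>M\<^esub> m \<in> P \<or> b \<odot>\<^bsub>M\<^esub> m \<in> P)"

definition classical_1_absorbing_prime_submodule ::
    "'m set \<Rightarrow> ('a, 'r) ring_scheme \<Rightarrow> ('a, 'm, 'k) module_scheme \<Rightarrow> bool"
  where "classical_1_absorbing_prime_submodule P A M \<longleftrightarrow>
    submodule P A M \<and> P \<noteq> carrier M \<and>
    (\<forall>a \<in> carrier A - Units A. \<forall>b \<in> carrier A - Units A. \<forall>c \<in> carrier A - Units A.
      \<forall>m \<in> carrier M.
      (a \<otimes>\<^bsub>A\<^esub> b \<otimes>\<^bsub>A\<^esub> c) \<odot>\<^bsub>M\<^esub> m \<in> P \<longrightarrow>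
        (a \<otimes>\<^bsub>A\<^esub> b) \<odot>\<^bsub>M\<^esub> m \<in> P \<or> c \<odot>\<^bsub>M\<^esub> m \<in> P)"

lemma RDirProd_sel:
  "(a, b) \<otimes>\<^bsub>RDirProd R S\<^esub> (c, d) = (a \<otimes>\<^bsub>R\<^esub> c, b \<otimes>\<^bsub>S\<^esub> d)"
  "\<one>\<^bsub>RDirProd R S\<^esub> = (\<one>\<^bsub>R\<^esub>, \<one>\<^bsub>S\<^esub>)"
  "(a, b) \<oplus>\<^bsub>RDirProd R S\<^esub> (c, d) = (a \<oplus>\<^bsub>R\<^esub> c, b \<oplus>\<^bsub>S\<^esub> d)"
  "\<zero>\<^bsub>RDirProd R S\<^esub> = (\<zero>\<^bsub>R\<^esub>, \<zero>\<^bsub>S\<^esub>)"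
  by (simp_all add: RDirProd_def DirProd_def monoid.defs)

lemma MDirProd_sel:
  "carrier (MDirProd M N) = carrier M \<times> carrier N"
  "(x, y) \<oplus>\<^bsub>MDirProd M N\<^esub> (x', y') = (x \<oplus>\<^bsub>M\<^esub> x', y \<oplus>\<^bsub>N\<^esub> y')"
  "\<zero>\<^bsub>MDirProd M N\<^esub> = (\<zero>\<^bsub>M\<^esub>, \<zero>\<^bsub>N\<^esub>)"
  "(a, b) \<odot>\<^bsub>MDirProd M N\<^esub> (x, y) = (a \<odot>\<^bsub>M\<^esub> x, b \<odot>\<^bsub>N\<^esub> y)"
  by (simp_all add: MDirProd_def RDirProd_def DirProd_def monoid.defs ring.defs module.defs)

lemma RDirProd_cring:
  assumes "cring R" and "cring S"
  shows "cring (RDirProd R S)"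
proof -
  interpret R: cring R by fact
  interpret S: cring S by fact
  interpret ring "RDirProd R S"
    by (rule RDirProd_ring) unfold_locales
  show ?thesis
    by unfold_locales (auto simp: RDirProd_carrier RDirProd_sel R.m_comm S.m_comm)
qed

lemma MDirProd_module:
  assumes "module R M" and "module S N"
  shows "module (RDirProd R S) (MDirProd M N)"
proof -
  interpret M: module R M by fact
  interpret N: module S N by fact
  show ?thesis
  proof (rule moduleI)
    show "cring (RDirProd R S)"
      by (rule RDirProd_cring) unfold_locales
    show "abelian_group (MDirProd M N)"
    proof (rule abelian_groupI)
      fix x assume "x \<in> carrier (MDirProd M N)"
      then obtain u v where x: "x = (u, v)" "u \<in> carrier M" "v \<in> carrier N"
        by (auto simp: MDirProd_sel)
      then show "\<exists>y \<in> carrier (MDirProd M N). y \<oplus>\<^bsub>MDirProd M N\<^esub> x = \<zero>\<^bsub>MDirProd M N\<^esub>"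
        by (intro bexI[of _ "(\<ominus>\<^bsub>M\<^esub> u, \<ominus>\<^bsub>N\<^esub> v)"])
          (auto simp: MDirProd_sel M.M.l_neg N.M.l_neg)
    qed (auto simp: MDirProd_sel M.M.a_ac N.M.a_ac)
  qed (auto simp: MDirProd_sel RDirProd_carrier RDirProd_sel M.smult_l_distr N.smult_l_distr
      M.smult_r_distr N.smult_r_distr M.smult_assoc1 N.smult_assoc1)
qed

lemma MDirProd_submodule:
  assumes "module R M" and "module S N" and "submodule P R M" and "submodule Q S N"
  shows "submodule (P \<times> Q) (RDirProd R S) (MDirProd M N)"
proof -
  interpret MN: module "RDirProd R S" "MDirProd M N"
    by (rule MDirProd_module) fact+
  note P = module.submoduleE[OF assms(1,3)] and Q = module.submoduleE[OF assms(2,4)]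
  show ?thesis
  proof (rule MN.submoduleI)
    show "P \<times> Q \<subseteq> carrier (MDirProd M N)"
      using P(1) Q(1) by (auto simp: MDirProd_sel)
    show "\<zero>\<^bsub>MDirProd M N\<^esub> \<in> P \<times> Q"
      using subgroup.one_closed[OF submodule.axioms(1)[OF assms(3)]]
        subgroup.one_closed[OF submodule.axioms(1)[OF assms(4)]]
      by (simp add: MDirProd_sel)
  next
    fix z assume "z \<in> P \<times> Q"
    then obtain x y where z: "z = (x, y)" "x \<in> P" "y \<in> Q" by auto
    have xy: "x \<in> carrier M" "y \<in> carrier N" using z P(1) Q(1) by auto
    interpret M: module R M by fact
    interpret N: module S N by fact
    have "\<ominus>\<^bsub>MDirProd M N\<^esub> z = (\<ominus>\<^bsub>M\<^esub> x, \<ominus>\<^bsub>N\<^esub> y)"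
      by (rule MN.M.minus_equality) (use z xy in \<open>auto simp: MDirProd_sel M.M.l_neg N.M.l_neg\<close>)
    then show "\<ominus>\<^bsub>MDirProd M N\<^esub> z \<in> P \<times> Q"
      using z P(3) Q(3) by simp
  qed (use P Q in \<open>auto simp: MDirProd_sel RDirProd_carrier\<close>)
qed

end

theory Submission
  imports Defs
begin

text \<open>
  The content lies in deducing (ii) from (i). The idempotents \<open>(\<one>, \<zero>)\<close> and \<open>(\<zero>, \<one>)\<close> of the
  product ring are nonunits, annihilate each other, and split \<open>M\<close> into its two factors; this gives
  enough nonunits to undo the restriction in the definition of a classical 1-absorbing prime
  submodule.

  If \<open>m1 \<notin> P1\<close> and \<open>m2 \<notin> P2\<close>, then the triple \<open>(\<one>, \<zero>)\<close>, \<open>(\<one>, \<zero>)\<close>, \<open>(\<zero>, \<one>)\<close> annihilates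
  \<open>(m1, m2)\<close>, while the product of the first two sends it to \<open>(m1, \<zero>)\<close> and the third to
  \<open>(\<zero>, m2)\<close>, neither of which is in \<open>P1 \<times> P2\<close>. So one factor of \<open>P\<close> is everything
  (\<open>absorbing_times_imp_full_factor\<close>). The other factor is classical prime: for arbitrary
  \<open>a, b\<close> in \<open>A2\<close>, units or not, the elements \<open>(\<zero>, \<one>)\<close>, \<open>(\<zero>, a)\<close>, \<open>(\<zero>, b)\<close> are
  nonunits, and the defining condition for this triple is the classical prime condition for
  \<open>a, b\<close> (\<open>absorbing_times_imp_classical_prime_right\<close> and its mirror image).

  That (ii) implies (iii) holds because membership in \<open>M1 \<times> P2\<close> is tested on the second
  coordinate alone, and (iii) implies (i) in any module by grouping \<open>abc\<close> as \<open>(ab)c\<close>.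
\<close>

lemma RDirProd_zero_snd_nonunit:
  assumes "cring S" and "\<one>\<^bsub>S\<^esub> \<noteq> \<zero>\<^bsub>S\<^esub>"
  shows "(a, \<zero>\<^bsub>S\<^esub>) \<notin> Units (RDirProd R S)"
proof -
  interpret S: cring S by fact
  show ?thesis
    using assms(2) by (auto simp: Units_def RDirProd_carrier RDirProd_sel)
qed

lemma RDirProd_zero_fst_nonunit:
  assumes "cring R" and "\<one>\<^bsub>R\<^esub> \<noteq> \<zero>\<^bsub>R\<^esub>"
  shows "(\<zero>\<^bsub>R\<^esub>, b) \<notin> Units (RDirProd R S)"
proof -
  interpret R: cring R by fact
  show ?thesis
    using assms(2) by (auto simp: Units_def RDirProd_carrier RDirProd_sel)
qed

lemma classical_1_absorbing_prime_submoduleD: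
  assumes "classical_1_absorbing_prime_submodule P A M"
    and "a \<in> carrier A - Units A" and "b \<in> carrier A - Units A" and "c \<in> carrier A - Units A"
    and "(a \<otimes>\<^bsub>A\<^esub> b \<otimes>\<^bsub>A\<^esub> c) \<odot>\<^bsub>M\<^esub> m \<in> P" and "m \<in> carrier M"
  shows "(a \<otimes>\<^bsub>A\<^esub> b) \<odot>\<^bsub>M\<^esub> m \<in> P \<or> c \<odot>\<^bsub>M\<^esub> m \<in> P"
  using assms unfolding classical_1_absorbing_prime_submodule_def by blast

lemma classical_prime_imp_1_absorbing:
  assumes "cring A" and "classical_prime_submodule P A M"
  shows "classical_1_absorbing_prime_submodule P A M"
proof -
  interpret A: cring A by fact
  show ?thesis
    using assms(2)
    unfolding classical_prime_submodule_def classical_1_absorbing_prime_submodule_def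
    by (meson A.m_closed DiffD1)
qed

text \<open>
  An element of \<open>M1 \<times> P2\<close> is recognised by its second coordinate, so the condition on the product
  is the condition on \<open>P2\<close>.
\<close>

lemma classical_prime_carrier_times:
  assumes "module A1 M1" and "module A2 M2" and P2: "classical_prime_submodule P2 A2 M2"
  shows "classical_prime_submodule (carrier M1 \<times> P2) (RDirProd A1 A2) (MDirProd M1 M2)"
proof -
  interpret M1: module A1 M1 by fact
  interpret M2: module A2 M2 by fact
  have "submodule (carrier M1 \<times> P2) (RDirProd A1 A2) (MDirProd M1 M2)"
    using P2 assms M1.carrier_is_submodule MDirProd_submodule
    unfolding classical_prime_submodule_def by blast
  moreover have "carrier M1 \<times> P2 \<noteq> carrier (MDirProd M1 M2)"
    using P2 M1.M.zero_closed unfolding classical_prime_submodule_def MDirProd_sel(1) by blast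
  ultimately show ?thesis
    using P2 unfolding classical_prime_submodule_def
    by (auto simp: MDirProd_sel RDirProd_carrier RDirProd_sel)
qed

lemma classical_prime_times_carrier:
  assumes "module A1 M1" and "module A2 M2" and P1: "classical_prime_submodule P1 A1 M1"
  shows "classical_prime_submodule (P1 \<times> carrier M2) (RDirProd A1 A2) (MDirProd M1 M2)"
proof -
  interpret M1: module A1 M1 by fact
  interpret M2: module A2 M2 by fact
  have "submodule (P1 \<times> carrier M2) (RDirProd A1 A2) (MDirProd M1 M2)"
    using P1 assms M2.carrier_is_submodule MDirProd_submodule
    unfolding classical_prime_submodule_def by blast
  moreover have "P1 \<times> carrier M2 \<noteq> carrier (MDirProd M1 M2)"
    using P1 M2.M.zero_closed unfolding classical_prime_submodule_def MDirProd_sel(1) by blast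
  ultimately show ?thesis
    using P1 unfolding classical_prime_submodule_def
    by (auto simp: MDirProd_sel RDirProd_carrier RDirProd_sel)
qed

text \<open>
  If both factors were proper, the triple \<open>(\<one>, \<zero>)\<close>, \<open>(\<one>, \<zero>)\<close>, \<open>(\<zero>, \<one>)\<close> of nonunits, whose
  product is zero, would violate the absorbing condition at a pair of elements outside
  \<open>P1\<close> and \<open>P2\<close>.
\<close>

lemma absorbing_times_imp_full_factor:
  assumes "module A1 M1" and "\<one>\<^bsub>A1\<^esub> \<noteq> \<zero>\<^bsub>A1\<^esub>" and "module A2 M2" and "\<one>\<^bsub>A2\<^esub> \<noteq> \<zero>\<^bsub>A2\<^esub>"
    and "submodule P1 A1 M1" and "submodule P2 A2 M2"
    and absorbing:
      "classical_1_absorbing_prime_submodule (P1 \<times> P2) (RDirProd A1 A2) (MDirProd M1 M2)"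
  shows "P1 = carrier M1 \<or> P2 = carrier M2"
proof (rule ccontr)
  interpret M1: module A1 M1 by fact
  interpret M2: module A2 M2 by fact
  assume "\<not> ?thesis"
  then obtain m1 m2 where m: "m1 \<in> carrier M1" "m1 \<notin> P1" "m2 \<in> carrier M2" "m2 \<notin> P2"
    using module.submoduleE(1)[OF assms(1,5)] module.submoduleE(1)[OF assms(3,6)] by blast
  have zero: "\<zero>\<^bsub>M1\<^esub> \<in> P1" "\<zero>\<^bsub>M2\<^esub> \<in> P2"
    using subgroup.one_closed[OF submodule.axioms(1)[OF assms(5)]]
      subgroup.one_closed[OF submodule.axioms(1)[OF assms(6)]] by simp_all
  let ?A = "RDirProd A1 A2" and ?M = "MDirProd M1 M2"
  let ?e = "(\<one>\<^bsub>A1\<^esub>, \<zero>\<^bsub>A2\<^esub>)" and ?f = "(\<zero>\<^bsub>A1\<^esub>, \<one>\<^bsub>A2\<^esub>)"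
  have ef: "?e \<in> carrier ?A - Units ?A" "?f \<in> carrier ?A - Units ?A"
    by (simp_all add: RDirProd_carrier RDirProd_zero_snd_nonunit[OF M2.R.cring_axioms assms(4)]
        RDirProd_zero_fst_nonunit[OF M1.R.cring_axioms assms(2)])
  have "(?e \<otimes>\<^bsub>?A\<^esub> ?e \<otimes>\<^bsub>?A\<^esub> ?f) \<odot>\<^bsub>?M\<^esub> (m1, m2) \<in> P1 \<times> P2"
    using m zero by (simp add: RDirProd_sel MDirProd_sel)
  moreover have "(m1, m2) \<in> carrier ?M"
    using m by (simp add: MDirProd_sel)
  ultimately have "(?e \<otimes>\<^bsub>?A\<^esub> ?e) \<odot>\<^bsub>?M\<^esub> (m1, m2) \<in> P1 \<times> P2 \<or> ?f \<odot>\<^bsub>?M\<^esub> (m1, m2) \<in> P1 \<times> P2"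
    by (rule classical_1_absorbing_prime_submoduleD[OF absorbing ef(1) ef(1) ef(2)])
  then show False
    using m by (simp add: RDirProd_sel MDirProd_sel)
qed

text \<open>
  Every element of \<open>{\<zero>} \<times> A2\<close> is a nonunit, even when its second coordinate is a unit. With
  \<open>(\<zero>, \<one>)\<close> as a harmless extra factor, the three-element condition on the product therefore
  yields the two-element condition for all of \<open>A2\<close>.
\<close>

lemma absorbing_times_imp_classical_prime_right:
  assumes "module A1 M1" and "module A2 M2" and "\<one>\<^bsub>A1\<^esub> \<noteq> \<zero>\<^bsub>A1\<^esub>"
    and "submodule P2 A2 M2"
    and absorbing:
      "classical_1_absorbing_prime_submodule (carrier M1 \<times> P2) (RDirProd A1 A2) (MDirProd M1 M2)"
  shows "classical_prime_submodule P2 A2 M2"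
  unfolding classical_prime_submodule_def
proof (intro conjI ballI impI)
  interpret M1: module A1 M1 by fact
  interpret M2: module A2 M2 by fact
  let ?A = "RDirProd A1 A2" and ?M = "MDirProd M1 M2"
  show "submodule P2 A2 M2" by fact
  show "P2 \<noteq> carrier M2"
    using absorbing unfolding classical_1_absorbing_prime_submodule_def MDirProd_sel(1) by blast
  fix a b m
  assume ab: "a \<in> carrier A2" "b \<in> carrier A2" and m: "m \<in> carrier M2"
    and abm: "(a \<otimes>\<^bsub>A2\<^esub> b) \<odot>\<^bsub>M2\<^esub> m \<in> P2"
  have nonunit: "(\<zero>\<^bsub>A1\<^esub>, x) \<in> carrier ?A - Units ?A" if "x \<in> carrier A2" for x
    using that
    by (simp add: RDirProd_carrier
        RDirProd_zero_fst_nonunit[OF M1.R.cring_axioms assms(3)])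
  have "((\<zero>\<^bsub>A1\<^esub>, \<one>\<^bsub>A2\<^esub>) \<otimes>\<^bsub>?A\<^esub> (\<zero>\<^bsub>A1\<^esub>, a) \<otimes>\<^bsub>?A\<^esub> (\<zero>\<^bsub>A1\<^esub>, b)) \<odot>\<^bsub>?M\<^esub> (\<zero>\<^bsub>M1\<^esub>, m) \<in> carrier M1 \<times> P2"
    using ab abm by (simp add: RDirProd_sel MDirProd_sel)
  moreover have "(\<zero>\<^bsub>M1\<^esub>, m) \<in> carrier ?M"
    using m by (simp add: MDirProd_sel)
  ultimately have "((\<zero>\<^bsub>A1\<^esub>, \<one>\<^bsub>A2\<^esub>) \<otimes>\<^bsub>?A\<^esub> (\<zero>\<^bsub>A1\<^esub>, a)) \<odot>\<^bsub>?M\<^esub> (\<zero>\<^bsub>M1\<^esub>, m) \<in> carrier M1 \<times> P2 \<or>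
      (\<zero>\<^bsub>A1\<^esub>, b) \<odot>\<^bsub>?M\<^esub> (\<zero>\<^bsub>M1\<^esub>, m) \<in> carrier M1 \<times> P2"
    by (rule classical_1_absorbing_prime_submoduleD[OF absorbing
          nonunit[OF M2.R.one_closed] nonunit[OF ab(1)] nonunit[OF ab(2)]])
  then show "a \<odot>\<^bsub>M2\<^esub> m \<in> P2 \<or> b \<odot>\<^bsub>M2\<^esub> m \<in> P2"
    using ab by (simp add: RDirProd_sel MDirProd_sel)
qed

lemma absorbing_times_imp_classical_prime_left:
  assumes "module A1 M1" and "module A2 M2" and "\<one>\<^bsub>A2\<^esub> \<noteq> \<zero>\<^bsub>A2\<^esub>"
    and "submodule P1 A1 M1"
    and absorbing:
      "classical_1_absorbing_prime_submodule (P1 \<times> carrier M2) (RDirProd A1 A2) (MDirProd M1 M2)"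
  shows "classical_prime_submodule P1 A1 M1"
  unfolding classical_prime_submodule_def
proof (intro conjI ballI impI)
  interpret M1: module A1 M1 by fact
  interpret M2: module A2 M2 by fact
  let ?A = "RDirProd A1 A2" and ?M = "MDirProd M1 M2"
  show "submodule P1 A1 M1" by fact
  show "P1 \<noteq> carrier M1"
    using absorbing unfolding classical_1_absorbing_prime_submodule_def MDirProd_sel(1) by blast
  fix a b m
  assume ab: "a \<in> carrier A1" "b \<in> carrier A1" and m: "m \<in> carrier M1"
    and abm: "(a \<otimes>\<^bsub>A1\<^esub> b) \<odot>\<^bsub>M1\<^esub> m \<in> P1"
  have nonunit: "(x, \<zero>\<^bsub>A2\<^esub>) \<in> carrier ?A - Units ?A" if "x \<in> carrier A1" for x
    using that
    by (simp add: RDirProd_carrier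
        RDirProd_zero_snd_nonunit[OF M2.R.cring_axioms assms(3)])
  have "((\<one>\<^bsub>A1\<^esub>, \<zero>\<^bsub>A2\<^esub>) \<otimes>\<^bsub>?A\<^esub> (a, \<zero>\<^bsub>A2\<^esub>) \<otimes>\<^bsub>?A\<^esub> (b, \<zero>\<^bsub>A2\<^esub>)) \<odot>\<^bsub>?M\<^esub> (m, \<zero>\<^bsub>M2\<^esub>) \<in> P1 \<times> carrier M2"
    using ab abm by (simp add: RDirProd_sel MDirProd_sel)
  moreover have "(m, \<zero>\<^bsub>M2\<^esub>) \<in> carrier ?M"
    using m by (simp add: MDirProd_sel)
  ultimately have "((\<one>\<^bsub>A1\<^esub>, \<zero>\<^bsub>A2\<^esub>) \<otimes>\<^bsub>?A\<^esub> (a, \<zero>\<^bsub>A2\<^esub>)) \<odot>\<^bsub>?M\<^esub> (m, \<zero>\<^bsub>M2\<^esub>) \<in> P1 \<times> carrier M2 \<or>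
      (b, \<zero>\<^bsub>A2\<^esub>) \<odot>\<^bsub>?M\<^esub> (m, \<zero>\<^bsub>M2\<^esub>) \<in> P1 \<times> carrier M2"
    by (rule classical_1_absorbing_prime_submoduleD[OF absorbing
          nonunit[OF M1.R.one_closed] nonunit[OF ab(1)] nonunit[OF ab(2)]])
  then show "a \<odot>\<^bsub>M1\<^esub> m \<in> P1 \<or> b \<odot>\<^bsub>M1\<^esub> m \<in> P1"
    using ab by (simp add: RDirProd_sel MDirProd_sel)
qed

theorem theorem9:
  fixes A1 :: "('a, 'r) ring_scheme" and A2 :: "('b, 's) ring_scheme"
    and M1 :: "('a, 'm, 'k) module_scheme" and M2 :: "('b, 'n, 'l) module_scheme"
    and P1 :: "'m set" and P2 :: "'n set"
  assumes "cring A1" and "\<one>\<^bsub>A1\<^esub> \<noteq> \<zero>\<^bsub>A1\<^esub>"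
    and "cring A2" and "\<one>\<^bsub>A2\<^esub> \<noteq> \<zero>\<^bsub>A2\<^esub>"
    and "module A1 M1" and "carrier M1 \<noteq> {\<zero>\<^bsub>M1\<^esub>}"
    and "module A2 M2" and "carrier M2 \<noteq> {\<zero>\<^bsub>M2\<^esub>}"
    and "submodule P1 A1 M1" and "submodule P2 A2 M2"
    and "P1 \<times> P2 \<noteq> carrier (MDirProd M1 M2)"
  shows
    "(classical_1_absorbing_prime_submodule (P1 \<times> P2) (RDirProd A1 A2) (MDirProd M1 M2) \<longleftrightarrow>
       (P1 = carrier M1 \<and> classical_prime_submodule P2 A2 M2 \<or>
        P2 = carrier M2 \<and> classical_prime_submodule P1 A1 M1)) \<and>
     ((P1 = carrier M1 \<and> classical_prime_submodule P2 A2 M2 \<or>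
        P2 = carrier M2 \<and> classical_prime_submodule P1 A1 M1) \<longleftrightarrow>
       classical_prime_submodule (P1 \<times> P2) (RDirProd A1 A2) (MDirProd M1 M2))"
proof -
  let ?P = "P1 \<times> P2" and ?A = "RDirProd A1 A2" and ?M = "MDirProd M1 M2"
  let ?ii = "P1 = carrier M1 \<and> classical_prime_submodule P2 A2 M2 \<or>
    P2 = carrier M2 \<and> classical_prime_submodule P1 A1 M1"
  have "?ii" if i: "classical_1_absorbing_prime_submodule ?P ?A ?M"
    using absorbing_times_imp_full_factor[OF assms(5,2,7,4,9,10) i]
  proof
    assume "P1 = carrier M1"
    then show ?thesis
      using absorbing_times_imp_classical_prime_right[OF assms(5,7,2,10)] i by simp
  next
    assume "P2 = carrier M2"
    then show ?thesis
      using absorbing_times_imp_classical_prime_left[OF assms(5,7,4,9)] i by simp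
  qed
  moreover have "classical_prime_submodule ?P ?A ?M" if ?ii
    using that classical_prime_carrier_times[OF assms(5,7)]
      classical_prime_times_carrier[OF assms(5,7)] by blast
  moreover have "classical_1_absorbing_prime_submodule ?P ?A ?M"
    if "classical_prime_submodule ?P ?A ?M"
    using RDirProd_cring[OF assms(1,3)] that by (rule classical_prime_imp_1_absorbing)
  ultimately show ?thesis by blast
qed

end
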